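(* Let $\mathcal{K}$ be a unital associative algebra over $\mathbb{C}$ (not necessarily commutative) and let $M$ be an $n\times n$ matrix over $\mathcal{K}$. Then each of the following four equalities in $\mathcal{K}\otimes \mathrm{Mat}_n\otimes \mathrm{Mat}_n$ is equivalent to $M$ being a Manin matrix (and hence they are equivalent to each other): (1) $[M\otimes1,1\otimes M]=P\,[M\otimes1,1\otimes M]$; (2) $\frac{1-P}{2}(M\otimes1)(1\otimes M)\frac{1-P}{2}=\frac{1-P}{2}(M\otimes1)(1\otimes M)$; (3) $\frac{1+P}{2}(1\otimes M)(M\otimes1)\frac{1+P}{2}=(M\otimes1)(1\otimes M)\frac{1+P}{2}$; (4) $(1-P)(1\otimes M)(M\otimes1)(1+P)=0$.
   Context: A (possibly rectangular) matrix $M=(M_{ij})$ with entries in an associative ring $\mathcal{K}$ is called a Manin matrix if (1) entries lying in the same column commute with each other, and (2) $[M_{ij},M_{kl}]=[M_{kj},M_{il}]$ for all $i,j,k,l$, where $[a,b]=ab-ba$. $\mathrm{Mat}_n$ is the algebra of $n\times n$ complex matrices, with matrix units $E_{ij}$. In $\mathcal{K}\otimes\mathrm{Mat}_n\otimes\mathrm{Mat}_n$ (tensor products over $\mathbb{C}$), $M\otimes1$ stands for $\sum_{i,j}M_{ij}\otimes E_{ij}\otimes1_{n\times n}$ and $1\otimes M$ stands for $\sum_{i,j}M_{ij}\otimes1_{n\times n}\otimes E_{ij}$. $P=\sum_{i,j}E_{ij}\otimes E_{ji}\in\mathrm{Mat}_n\otimes\mathrm{Mat}_n$ (regarded as $1_{\mathcal{K}}\otimes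 P$) is the permutation operator, $P(a\otimes b)=b\otimes a$; in $1\pm P$ the symbol $1$ is the identity of $\mathrm{Mat}_n\otimes\mathrm{Mat}_n$. *)

theory Defs
  imports "HOL-Analysis.Cartesian_Space"
begin

section \<open>Unital associative algebras over the complex numbers\<close>

text \<open>
  The class is built on \<^class>\<open>ring\<close> and \<^class>\<open>monoid_mult\<close> instead of \<^class>\<open>ring_1\<close>, because the
  latter excludes the zero algebra.
\<close>

class complex_algebra = ring + monoid_mult +
  fixes scaleC :: "complex \<Rightarrow> 'a \<Rightarrow> 'a"  (infixr \<open>*\<^sub>C\<close> 75)
  assumes scaleC_add_right: "a *\<^sub>C (x + y) = a *\<^sub>C x + a *\<^sub>C y"
    and scaleC_add_left: "(a + b) *\<^sub>C x = a *\<^sub>C x + b *\<^sub>C x"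
    and scaleC_scaleC: "a *\<^sub>C b *\<^sub>C x = (a * b) *\<^sub>C x"
    and scaleC_one: "1 *\<^sub>C x = x"
    and mult_scaleC_left: "(a *\<^sub>C x) * y = a *\<^sub>C (x * y)"
    and mult_scaleC_right: "x * (a *\<^sub>C y) = a *\<^sub>C (x * y)"

interpretation complex_algebra: vector_space "scaleC :: complex \<Rightarrow> 'a \<Rightarrow> 'a::complex_algebra"
  by standard (auto simp: scaleC_add_right scaleC_add_left scaleC_scaleC scaleC_one)

definition commutator :: "'a::ring \<Rightarrow> 'a \<Rightarrow> 'a"
  where "commutator a b = a * b - b * a"


section \<open>Manin matrices\<close>

definition manin_matrix :: "'k::ring ^ 'm ^ 'n \<Rightarrow> bool"
  where "manin_matrix M \<longleftrightarrow>
    (\<forall>i k j. M $ i $ j * M $ k $ j = M $ k $ j * M $ i $ j) \<and>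
    (\<forall>i j k l. commutator (M $ i $ j) (M $ k $ l) = commutator (M $ k $ j) (M $ i $ l))"


section \<open>The algebra \<open>\<K> \<otimes> Mat\<^sub>n \<otimes> Mat\<^sub>n\<close>\<close>

text \<open>
  \<open>Mat\<^sub>n\<close> is \<open>complex ^ 'n ^ 'n\<close> with the product \<open>**\<close>. The tensor product over the complex numbers
  is realised by matrices over \<open>\<K>\<close> with rows and columns indexed by pairs: the coefficient of
  \<open>E\<^sub>i\<^sub>j \<otimes> E\<^sub>p\<^sub>q\<close> is the entry in row \<open>(i, p)\<close> and column \<open>(j, q)\<close>. The theorems \<open>tensor_universal\<close>,
  \<open>tensor_linear\<close>, \<open>tensor_mult\<close> and \<open>tensor_one\<close> below show that this is the tensor product of the
  three algebras: pure tensors are trilinear and universal with this property, and they are multiplied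
  factor by factor.
\<close>

typedef ('k, 'n) tensor_algebra = "UNIV :: ('n \<times> 'n \<Rightarrow> 'n \<times> 'n \<Rightarrow> 'k) set"
  morphisms coeff Abs_tensor_algebra
  by simp

setup_lifting type_definition_tensor_algebra

instantiation tensor_algebra :: (complex_algebra, finite) complex_algebra
begin

lift_definition zero_tensor_algebra :: "('a, 'b) tensor_algebra" is "\<lambda>r c. 0" .

lift_definition one_tensor_algebra :: "('a, 'b) tensor_algebra"
  is "\<lambda>r c. if r = c then 1 else 0" .

lift_definition plus_tensor_algebra ::
  "('a, 'b) tensor_algebra \<Rightarrow> ('a, 'b) tensor_algebra \<Rightarrow> ('a, 'b) tensor_algebra"
  is "\<lambda>s t r c. s r c + t r c" .

lift_definition minus_tensor_algebra ::
  "('a, 'b) tensor_algebra \<Rightarrow> ('a, 'b) tensor_algebra \<Rightarrow> ('a, 'b) tensor_algebra"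
  is "\<lambda>s t r c. s r c - t r c" .

lift_definition uminus_tensor_algebra :: "('a, 'b) tensor_algebra \<Rightarrow> ('a, 'b) tensor_algebra"
  is "\<lambda>t r c. - t r c" .

lift_definition times_tensor_algebra ::
  "('a, 'b) tensor_algebra \<Rightarrow> ('a, 'b) tensor_algebra \<Rightarrow> ('a, 'b) tensor_algebra"
  is "\<lambda>s t r c. \<Sum>m\<in>UNIV. s r m * t m c" .

lift_definition scaleC_tensor_algebra ::
  "complex \<Rightarrow> ('a, 'b) tensor_algebra \<Rightarrow> ('a, 'b) tensor_algebra"
  is "\<lambda>a t r c. a *\<^sub>C t r c" .

instance
proof
  fix s t u :: "('a, 'b) tensor_algebra" and a b :: complex
  show "s + t + u = s + (t + u)" by transfer (simp add: add.assoc)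
  show "s + t = t + s" by transfer (simp add: add.commute)
  show "0 + s = s" by transfer simp
  show "- s + s = 0" by transfer simp
  show "s - t = s + - t" by transfer simp
  show "s * t * u = s * (t * u)"
  proof (transfer, intro ext)
    fix s t u :: "'b \<times> 'b \<Rightarrow> 'b \<times> 'b \<Rightarrow> 'a" and r c
    have "(\<Sum>m\<in>UNIV. (\<Sum>k\<in>UNIV. s r k * t k m) * u m c)
        = (\<Sum>m\<in>UNIV. \<Sum>k\<in>UNIV. s r k * (t k m * u m c))"
      by (simp add: sum_distrib_right mult.assoc)
    also have "\<dots> = (\<Sum>k\<in>UNIV. \<Sum>m\<in>UNIV. s r k * (t k m * u m c))"
      by (rule sum.swap)
    finally show "(\<Sum>m\<in>UNIV. (\<Sum>k\<in>UNIV. s r k * t k m) * u m c)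
        = (\<Sum>k\<in>UNIV. s r k * (\<Sum>m\<in>UNIV. t k m * u m c))"
      by (simp add: sum_distrib_left)
  qed
  show "(s + t) * u = s * u + t * u" by transfer (simp add: distrib_right sum.distrib)
  show "s * (t + u) = s * t + s * u" by transfer (simp add: distrib_left sum.distrib)
  show "1 * s = s"
    by transfer (simp add: if_distrib[of "\<lambda>x. x * _"] cong: if_cong)
  show "s * 1 = s"
    by transfer (simp add: if_distrib[of "\<lambda>x. _ * x"] cong: if_cong)
  show "a *\<^sub>C (s + t) = a *\<^sub>C s + a *\<^sub>C t" by transfer (simp add: scaleC_add_right)
  show "(a + b) *\<^sub>C s = a *\<^sub>C s + b *\<^sub>C s" by transfer (simp add: scaleC_add_left)
  show "a *\<^sub>C b *\<^sub>C s = (a * b) *\<^sub>C s" by transfer (simp add: scaleC_scaleC)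
  show "1 *\<^sub>C s = s" by transfer (simp add: scaleC_one)
  show "(a *\<^sub>C s) * t = a *\<^sub>C (s * t)"
    by transfer (simp add: mult_scaleC_left complex_algebra.scale_sum_right)
  show "s * (a *\<^sub>C t) = a *\<^sub>C (s * t)"
    by transfer (simp add: mult_scaleC_right complex_algebra.scale_sum_right)
qed

end

lift_definition tensor ::
  "'k::complex_algebra \<Rightarrow> complex ^ 'n ^ 'n \<Rightarrow> complex ^ 'n ^ 'n \<Rightarrow> ('k, 'n::finite) tensor_algebra"
  is "\<lambda>x A B (i, p) (j, q). (A $ i $ j * B $ p $ q) *\<^sub>C x" .

definition matrix_unit :: "'n \<Rightarrow> 'n \<Rightarrow> complex ^ 'n ^ 'n"
  where "matrix_unit i j = (\<chi> a b. if a = i \<and> b = j then 1 else 0)"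

definition matrix_scale :: "complex \<Rightarrow> complex ^ 'n ^ 'n \<Rightarrow> complex ^ 'n ^ 'n"
  where "matrix_scale c A = (\<chi> i j. c * A $ i $ j)"

lemma vector_space_matrix: "vector_space (matrix_scale :: complex \<Rightarrow> complex ^ 'n ^ 'n \<Rightarrow> _)"
  by standard (simp_all add: matrix_scale_def vec_eq_iff algebra_simps)

lemma coeff_sum: "coeff (sum f S) r c = (\<Sum>x\<in>S. coeff (f x) r c)"
  by (induction S rule: infinite_finite_induct)
    (simp_all add: zero_tensor_algebra.rep_eq plus_tensor_algebra.rep_eq)

lemma coeff_tensor: "coeff (tensor x A B) (i, p) (j, q) = (A $ i $ j * B $ p $ q) *\<^sub>C x"
  by (simp add: tensor.rep_eq)

lemma tensor_algebra_eqI: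
  assumes "\<And>i p j q. coeff s (i, p) (j, q) = coeff t (i, p) (j, q)"
  shows "s = t"
  using assms by (metis coeff_inject ext surj_pair)

lemma matrix_unit_expansion:
  "(A :: complex ^ 'n ^ 'n) = (\<Sum>i\<in>UNIV. \<Sum>j\<in>UNIV. matrix_scale (A $ i $ j) (matrix_unit i j))"
proof -
  have "(\<Sum>i\<in>UNIV. \<Sum>j\<in>UNIV. A $ i $ j * (if a = i \<and> b = j then 1 else 0)) = A $ a $ b" for a b
  proof -
    have "(\<Sum>j\<in>UNIV. A $ i $ j * (if a = i \<and> b = j then 1 else 0))
        = (if a = i then A $ i $ b else 0)" for i
      by (cases "a = i") (simp_all add: if_distrib[of "\<lambda>x. _ * x"] cong: if_cong)
    then show ?thesis by simp
  qed
  then show ?thesis by (simp add: vec_eq_iff matrix_scale_def matrix_unit_def)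
qed

lemma tensor_expansion:
  "t = (\<Sum>i\<in>UNIV. \<Sum>j\<in>UNIV. \<Sum>p\<in>UNIV. \<Sum>q\<in>UNIV.
          tensor (coeff t (i, p) (j, q)) (matrix_unit i j) (matrix_unit p q))"
proof (rule tensor_algebra_eqI)
  fix a b c d
  have "(\<Sum>i\<in>UNIV. \<Sum>j\<in>UNIV. \<Sum>p\<in>UNIV. \<Sum>q\<in>UNIV.
            ((if a = i \<and> c = j then 1 else 0) * (if b = p \<and> d = q then 1 else 0))
              *\<^sub>C coeff t (i, p) (j, q))
      = (\<Sum>i\<in>UNIV. \<Sum>j\<in>UNIV. \<Sum>p\<in>UNIV. \<Sum>q\<in>UNIV. if q = d then if p = b then if j = c then
            if i = a then coeff t (i, p) (j, q) else 0 else 0 else 0 else 0)"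
    by (intro sum.cong refl) (auto simp: scaleC_one)
  also have "\<dots> = coeff t (a, b) (c, d)" by simp
  finally show "coeff t (a, b) (c, d) = coeff (\<Sum>i\<in>UNIV. \<Sum>j\<in>UNIV. \<Sum>p\<in>UNIV. \<Sum>q\<in>UNIV.
          tensor (coeff t (i, p) (j, q)) (matrix_unit i j) (matrix_unit p q)) (a, b) (c, d)"
    by (simp add: coeff_sum coeff_tensor matrix_unit_def)
qed

definition trilinear ::
  "(complex \<Rightarrow> 'v::ab_group_add \<Rightarrow> 'v) \<Rightarrow>
    ('k::complex_algebra \<Rightarrow> complex ^ 'n ^ 'n \<Rightarrow> complex ^ 'n ^ 'n \<Rightarrow> 'v) \<Rightarrow> bool"
  where "trilinear smul f \<longleftrightarrow>
    (\<forall>A B. Vector_Spaces.linear scaleC smul (\<lambda>x. f x A B)) \<and>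
    (\<forall>x B. Vector_Spaces.linear matrix_scale smul (\<lambda>A. f x A B)) \<and>
    (\<forall>x A. Vector_Spaces.linear matrix_scale smul (\<lambda>B. f x A B))"

theorem tensor_linear: "trilinear scaleC tensor"
  unfolding trilinear_def Vector_Spaces.linear_iff
  by (auto intro!: vector_space_matrix complex_algebra.vector_space_axioms tensor_algebra_eqI
      simp: coeff_tensor plus_tensor_algebra.rep_eq scaleC_tensor_algebra.rep_eq
        matrix_scale_def scaleC_add_left scaleC_add_right distrib_left distrib_right mult_ac)

theorem tensor_universal:
  fixes smul :: "complex \<Rightarrow> 'v::ab_group_add \<Rightarrow> 'v"
    and f :: "'k::complex_algebra \<Rightarrow> complex ^ 'n ^ 'n \<Rightarrow> complex ^ 'n ^ 'n \<Rightarrow> 'v"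
  assumes "trilinear smul f"
  shows "\<exists>!g. Vector_Spaces.linear scaleC smul g \<and> (\<forall>x A B. g (tensor x A B) = f x A B)"
proof (rule ex1I)
  have lin: "Vector_Spaces.linear scaleC smul (\<lambda>x. f x A B)"
    "Vector_Spaces.linear matrix_scale smul (\<lambda>A. f x A B)"
    "Vector_Spaces.linear matrix_scale smul (\<lambda>B. f x A B)" for x A B
    using assms by (auto simp: trilinear_def)
  note vs = lin(1)[unfolded Vector_Spaces.linear_iff]
  interpret V: vector_space smul using vs by blast
  have add: "f (x + y) A B = f x A B + f y A B" and smul: "f (a *\<^sub>C x) A B = smul a (f x A B)"
    for a x y A B using vs by auto
  define g where "g t = (\<Sum>i\<in>UNIV. \<Sum>j\<in>UNIV. \<Sum>p\<in>UNIV. \<Sum>q\<in>UNIV.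
     f (coeff t (i, p) (j, q)) (matrix_unit i j) (matrix_unit p q))" for t
  have "Vector_Spaces.linear scaleC smul g"
    unfolding Vector_Spaces.linear_iff
    by (auto simp: g_def plus_tensor_algebra.rep_eq scaleC_tensor_algebra.rep_eq add smul
        sum.distrib V.scale_sum_right complex_algebra.vector_space_axioms V.vector_space_axioms)
  moreover have "g (tensor x A B) = f x A B" for x A B
  proof -
    have sum2: "f x (sum F S) B = (\<Sum>s\<in>S. f x (F s) B)" for x B S and F :: "'n \<Rightarrow> _"
      using module_hom.sum[OF lin(2)[unfolded linear_iff_module_hom]] by blast
    have sum3: "f x A (sum F S) = (\<Sum>s\<in>S. f x A (F s))" for x A S and F :: "'n \<Rightarrow> _"
      using module_hom.sum[OF lin(3)[unfolded linear_iff_module_hom]] by blast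
    have scale2: "f x (matrix_scale a A) B = smul a (f x A B)"
      and scale3: "f x A (matrix_scale a B) = smul a (f x A B)" for a x A B
      using lin(2,3) by (auto simp: Vector_Spaces.linear_iff)
    have "f x A B = f x (\<Sum>i\<in>UNIV. \<Sum>j\<in>UNIV. matrix_scale (A $ i $ j) (matrix_unit i j)) B"
      by (simp flip: matrix_unit_expansion)
    also have "\<dots> = (\<Sum>i\<in>UNIV. \<Sum>j\<in>UNIV. smul (A $ i $ j) (f x (matrix_unit i j) B))"
      by (simp add: sum2 scale2)
    also have "\<dots> = (\<Sum>i\<in>UNIV. \<Sum>j\<in>UNIV. smul (A $ i $ j) (f x (matrix_unit i j)
        (\<Sum>p\<in>UNIV. \<Sum>q\<in>UNIV. matrix_scale (B $ p $ q) (matrix_unit p q))))"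
      by (simp flip: matrix_unit_expansion)
    also have "\<dots> = g (tensor x A B)"
      by (simp add: g_def sum3 scale3 coeff_tensor smul V.scale_sum_right)
    finally show ?thesis by simp
  qed
  ultimately show "Vector_Spaces.linear scaleC smul g \<and> (\<forall>x A B. g (tensor x A B) = f x A B)"
    by blast
  fix h :: "('k, 'n) tensor_algebra \<Rightarrow> 'v"
  assume h: "Vector_Spaces.linear scaleC smul h \<and> (\<forall>x A B. h (tensor x A B) = f x A B)"
  have hsum: "h (sum F S) = (\<Sum>s\<in>S. h (F s))" for S and F :: "'n \<Rightarrow> _"
    using module_hom.sum h linear_iff_module_hom by blast
  show "h = g"
  proof
    fix t
    have "h t = h (\<Sum>i\<in>UNIV. \<Sum>j\<in>UNIV. \<Sum>p\<in>UNIV. \<Sum>q\<in>UNIV.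
          tensor (coeff t (i, p) (j, q)) (matrix_unit i j) (matrix_unit p q))"
      using tensor_expansion[of t] by (rule arg_cong)
    then show "h t = g t" using h by (simp add: hsum g_def)
  qed
qed

theorem tensor_one: "tensor 1 (mat 1) (mat 1) = 1"
  by (rule tensor_algebra_eqI) (auto simp: coeff_tensor one_tensor_algebra.rep_eq mat_def scaleC_one)

theorem tensor_mult: "tensor x A B * tensor y C D = tensor (x * y) (A ** C) (B ** D)"
proof (rule tensor_algebra_eqI)
  fix i p j q
  have "coeff (tensor x A B * tensor y C D) (i, p) (j, q)
      = (\<Sum>(m, k)\<in>UNIV \<times> UNIV. ((A $ i $ m * C $ m $ j) * (B $ p $ k * D $ k $ q)) *\<^sub>C (x * y))"
    unfolding times_tensor_algebra.rep_eq UNIV_Times_UNIV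
    by (intro sum.cong refl)
      (auto simp: coeff_tensor mult_scaleC_left mult_scaleC_right scaleC_scaleC mult_ac)
  also have "\<dots> = ((\<Sum>m\<in>UNIV. A $ i $ m * C $ m $ j) * (\<Sum>k\<in>UNIV. B $ p $ k * D $ k $ q)) *\<^sub>C (x * y)"
    by (simp add: sum_product complex_algebra.scale_sum_left sum.cartesian_product case_prod_unfold del: UNIV_Times_UNIV)
  finally show "coeff (tensor x A B * tensor y C D) (i, p) (j, q)
      = coeff (tensor (x * y) (A ** C) (B ** D)) (i, p) (j, q)"
    by (simp add: coeff_tensor matrix_matrix_mult_def)
qed

text \<open>The elements \<open>M \<otimes> 1\<close>, \<open>1 \<otimes> M\<close> and the permutation operator \<open>P\<close>, regarded as \<open>1 \<otimes> P\<close>.\<close>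

definition tensor_left :: "'k::complex_algebra ^ 'n ^ 'n \<Rightarrow> ('k, 'n::finite) tensor_algebra"
  where "tensor_left M = (\<Sum>i\<in>UNIV. \<Sum>j\<in>UNIV. tensor (M $ i $ j) (matrix_unit i j) (mat 1))"

definition tensor_right :: "'k::complex_algebra ^ 'n ^ 'n \<Rightarrow> ('k, 'n::finite) tensor_algebra"
  where "tensor_right M = (\<Sum>i\<in>UNIV. \<Sum>j\<in>UNIV. tensor (M $ i $ j) (mat 1) (matrix_unit i j))"

definition perm_op :: "('k::complex_algebra, 'n::finite) tensor_algebra"
  where "perm_op = (\<Sum>i\<in>UNIV. \<Sum>j\<in>UNIV. tensor 1 (matrix_unit i j) (matrix_unit j i))"

end

(* Write a = M \<otimes> 1, b = 1 \<otimes> M and p = P. Since p p = 1 and b a = p a b p, each of the four equalities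
   is equivalent to (1 - p) a b (1 + p) = 0. The coefficients of this element are the differences
   [M_ij, M_pq] - [M_pj, M_iq], and for j = q their vanishing says that twice the commutator of two
   entries of column j is zero. *)

theory Submission
  imports Defs
begin

lemma scaleC_cancel_left:
  fixes x y :: "'a::complex_algebra"
  assumes "c \<noteq> 0"
  shows "c *\<^sub>C x = c *\<^sub>C y \<longleftrightarrow> x = y"
  using assms by (metis left_inverse scaleC_one scaleC_scaleC)

lemma scaleC_half_double: "(1/2) *\<^sub>C (x + x) = (x :: 'a::complex_algebra)"
  by (simp add: scaleC_add_right scaleC_one flip: scaleC_add_left)

lemma double_eq_0_iff: "x + x = 0 \<longleftrightarrow> (x :: 'a::complex_algebra) = 0"
  by (metis add_0 scaleC_half_double)

text \<open>Clears denominators in the projector equalities: the side with two factors 1/2 collects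
  the scalar 1/4, the other side only 1/2.\<close>

lemma scaleC_quarter_eq_half_iff:
  fixes x y :: "'a::complex_algebra"
  shows "(1/4) *\<^sub>C x = (1/2) *\<^sub>C y \<longleftrightarrow> x = y + y"
proof -
  have "(1/2) *\<^sub>C y = (1/4) *\<^sub>C (y + y)"
    by (simp add: scaleC_add_right flip: scaleC_add_left)
  then show ?thesis by (simp add: scaleC_cancel_left)
qed

context
  fixes a b p :: "'a::complex_algebra"
  assumes involution: "p * p = 1" and flip: "b * a = p * (a * b) * p"
begin

private lemma p_p_mult: "p * (p * x) = x"
  by (simp add: involution flip: mult.assoc)

text \<open>The form of \<open>flip\<close> that matches inside right-associated products. Together
  with \<open>p_p_mult\<close> it brings every word to a normal form in which \<open>a\<close>
  stands before \<open>b\<close> and no \<open>p * p\<close> remains.\<close>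

private lemma b_a_mult: "b * (a * x) = p * (a * (b * (p * x)))"
  using flip by (metis mult.assoc)

private lemmas expand = algebra_simps p_p_mult b_a_mult involution flip

text \<open>As \<open>p * (b * a) = a * b * p\<close>, the difference of the two sides is
  \<open>a b - p a b p - p a b + a b p\<close>, which factors as claimed.\<close>

lemma commutator_flip_iff:
  "commutator a b = p * commutator a b \<longleftrightarrow> (1 - p) * (a * b) * (1 + p) = 0"
proof -
  have "commutator a b - p * commutator a b = (1 - p) * (a * b) * (1 + p)"
    by (simp add: commutator_def expand)
  then show ?thesis by (metis eq_iff_diff_eq_0)
qed

text \<open>For \<open>x = (1 - p) * (a * b)\<close> the equality reads
  \<open>x * (1 - p) = 2 x\<close>, and \<open>2 - (1 - p) = 1 + p\<close>.\<close>

lemma antisymmetrizer_absorb_iff: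
  "((1/2) *\<^sub>C (1 - p)) * a * b * ((1/2) *\<^sub>C (1 - p)) = ((1/2) *\<^sub>C (1 - p)) * a * b
    \<longleftrightarrow> (1 - p) * (a * b) * (1 + p) = 0"
proof -
  let ?x = "(1 - p) * (a * b)"
  have "((1/2) *\<^sub>C (1 - p)) * a * b * ((1/2) *\<^sub>C (1 - p)) = ((1/2) *\<^sub>C (1 - p)) * a * b
      \<longleftrightarrow> ?x * (1 - p) = ?x + ?x"
    by (simp add: mult_scaleC_left mult_scaleC_right scaleC_scaleC scaleC_quarter_eq_half_iff mult.assoc)
  also have "\<dots> \<longleftrightarrow> ?x + ?x - ?x * (1 - p) = 0"
    by (metis eq_iff_diff_eq_0)
  also have "?x + ?x - ?x * (1 - p) = ?x * (1 + p)"
    by (simp add: algebra_simps)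
  finally show ?thesis .
qed

text \<open>The factor \<open>1 + p\<close> absorbs \<open>p\<close> on either side, so
  \<open>(1 + p) b a (1 + p) = (1 + p) a b (1 + p)\<close>. Subtracting this from
  \<open>2 a b (1 + p)\<close> leaves the factor \<open>2 - (1 + p) = 1 - p\<close> on the
  left.\<close>

lemma symmetrizer_absorb_iff:
  "((1/2) *\<^sub>C (1 + p)) * b * a * ((1/2) *\<^sub>C (1 + p)) = a * b * ((1/2) *\<^sub>C (1 + p))
    \<longleftrightarrow> (1 - p) * (a * b) * (1 + p) = 0"
proof -
  let ?y = "a * b * (1 + p)"
  have "((1/2) *\<^sub>C (1 + p)) * b * a * ((1/2) *\<^sub>C (1 + p)) = a * b * ((1/2) *\<^sub>C (1 + p))
      \<longleftrightarrow> (1 + p) * b * a * (1 + p) = ?y + ?y"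
    by (simp add: mult_scaleC_left mult_scaleC_right scaleC_scaleC scaleC_quarter_eq_half_iff)
  also have "\<dots> \<longleftrightarrow> ?y + ?y - (1 + p) * b * a * (1 + p) = 0"
    by (metis eq_iff_diff_eq_0)
  also have "?y + ?y - (1 + p) * b * a * (1 + p) = (1 - p) * (a * b) * (1 + p)"
    by (simp add: expand)
  finally show ?thesis .
qed

text \<open>Replacing \<open>b a\<close> by \<open>p a b p\<close> only changes the sign, because
  \<open>(1 - p) p = -(1 - p)\<close> and \<open>p (1 + p) = 1 + p\<close>.\<close>

lemma antisymmetrizer_symmetrizer_iff:
  "(1 - p) * b * a * (1 + p) = 0 \<longleftrightarrow> (1 - p) * (a * b) * (1 + p) = 0"
proof -
  have "(1 - p) * b * a * (1 + p) = - ((1 - p) * (a * b) * (1 + p))"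
    by (simp add: expand)
  then show ?thesis by simp
qed

end

lemma coeff_times:
  "coeff (s * t) (i, p) (j, q) = (\<Sum>m\<in>UNIV. \<Sum>k\<in>UNIV. coeff s (i, p) (m, k) * coeff t (m, k) (j, q))"
  by (simp add: times_tensor_algebra.rep_eq sum.cartesian_product case_prod_unfold)

lemma coeff_tensor_left:
  fixes M :: "'k::complex_algebra ^ 'n::finite ^ 'n"
  shows "coeff (tensor_left M) (i, p) (j, q) = (if p = q then M $ i $ j else 0)"
proof -
  \<comment> \<open>The conditions are nested with that of the inner summation index outermost, so
    that each sum collapses in turn to a single term.\<close>
  have "coeff (tensor_left M) (i, p) (j, q)
      = (\<Sum>a\<in>UNIV. \<Sum>b\<in>UNIV. if b = j then if a = i then if p = q then M $ a $ b else 0 else 0 else 0)"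
    unfolding tensor_left_def coeff_sum coeff_tensor
    by (intro sum.cong refl) (auto simp: matrix_unit_def mat_def scaleC_one)
  then show ?thesis by simp
qed

lemma coeff_tensor_right:
  fixes M :: "'k::complex_algebra ^ 'n::finite ^ 'n"
  shows "coeff (tensor_right M) (i, p) (j, q) = (if i = j then M $ p $ q else 0)"
proof -
  have "coeff (tensor_right M) (i, p) (j, q)
      = (\<Sum>a\<in>UNIV. \<Sum>b\<in>UNIV. if b = q then if a = p then if i = j then M $ a $ b else 0 else 0 else 0)"
    unfolding tensor_right_def coeff_sum coeff_tensor
    by (intro sum.cong refl) (auto simp: matrix_unit_def mat_def scaleC_one)
  then show ?thesis by simp
qed

lemma coeff_perm_op:
  "coeff (perm_op :: ('k::complex_algebra, 'n::finite) tensor_algebra) (i, p) (j, q)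
    = (if j = p then if q = i then 1 else 0 else 0)"
proof -
  have "coeff (perm_op :: ('k, 'n) tensor_algebra) (i, p) (j, q)
      = (\<Sum>a\<in>UNIV. \<Sum>b\<in>UNIV. if b = j then if a = i then if j = p then if q = i then 1 else 0 else 0
          else 0 else 0)"
    unfolding perm_op_def coeff_sum coeff_tensor
    by (intro sum.cong refl) (auto simp: matrix_unit_def scaleC_one)
  then show ?thesis by simp
qed

lemma coeff_perm_op_mult: "coeff (perm_op * t) (i, p) (j, q) = coeff t (p, i) (j, q)"
proof -
  have "coeff (perm_op * t) (i, p) (j, q)
      = (\<Sum>m\<in>UNIV. \<Sum>k\<in>UNIV. if k = i then if m = p then coeff t (m, k) (j, q) else 0 else 0)"
    unfolding coeff_times coeff_perm_op by (intro sum.cong refl) auto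
  then show ?thesis by simp
qed

lemma coeff_mult_perm_op: "coeff (t * perm_op) (i, p) (j, q) = coeff t (i, p) (q, j)"
proof -
  have "coeff (t * perm_op) (i, p) (j, q)
      = (\<Sum>m\<in>UNIV. \<Sum>k\<in>UNIV. if k = j then if m = q then coeff t (i, p) (m, k) else 0 else 0)"
    unfolding coeff_times coeff_perm_op by (intro sum.cong refl) auto
  then show ?thesis by simp
qed

lemma perm_op_involution: "perm_op * perm_op = (1 :: ('k::complex_algebra, 'n::finite) tensor_algebra)"
  by (rule tensor_algebra_eqI)
    (auto simp: coeff_perm_op_mult coeff_perm_op one_tensor_algebra.rep_eq)

lemma coeff_left_right:
  "coeff (tensor_left M * tensor_right M) (i, p) (j, q) = M $ i $ j * M $ p $ q"
proof -
  have "coeff (tensor_left M * tensor_right M) (i, p) (j, q)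
      = (\<Sum>m\<in>UNIV. \<Sum>k\<in>UNIV. if k = p then if m = j then M $ i $ m * M $ k $ q else 0 else 0)"
    unfolding coeff_times coeff_tensor_left coeff_tensor_right by (intro sum.cong refl) auto
  then show ?thesis by simp
qed

lemma coeff_right_left:
  "coeff (tensor_right M * tensor_left M) (i, p) (j, q) = M $ p $ q * M $ i $ j"
proof -
  have "coeff (tensor_right M * tensor_left M) (i, p) (j, q)
      = (\<Sum>m\<in>UNIV. \<Sum>k\<in>UNIV. if k = q then if m = i then M $ p $ k * M $ m $ j else 0 else 0)"
    unfolding coeff_times coeff_tensor_left coeff_tensor_right by (intro sum.cong refl) auto
  then show ?thesis by simp
qed

text \<open>Conjugation by the permutation exchanges the two row indices and the two column indices,
  which turns the coefficient \<open>M $ i $ j * M $ p $ q\<close> into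
  \<open>M $ p $ q * M $ i $ j\<close>.\<close>

lemma right_left_eq_conjugate:
  "tensor_right M * tensor_left M = perm_op * (tensor_left M * tensor_right M) * perm_op"
  by (rule tensor_algebra_eqI)
    (simp add: coeff_mult_perm_op coeff_perm_op_mult coeff_left_right coeff_right_left)

lemma manin_matrix_iff_cross_commutator:
  fixes M :: "'k::complex_algebra ^ 'm ^ 'n"
  shows "manin_matrix M \<longleftrightarrow>
    (\<forall>i j k l. commutator (M $ i $ j) (M $ k $ l) = commutator (M $ k $ j) (M $ i $ l))"
proof -
  have "M $ i $ j * M $ k $ j = M $ k $ j * M $ i $ j"
    if "commutator (M $ i $ j) (M $ k $ j) = commutator (M $ k $ j) (M $ i $ j)" for i j k
  proof -
    let ?c = "commutator (M $ i $ j) (M $ k $ j)"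
    \<comment> \<open>By the assumption \<open>?c\<close> equals the commutator with its arguments
      exchanged, which is \<open>- ?c\<close>. Over the complex numbers 2 is invertible, so
      \<open>?c\<close> vanishes.\<close>
    have "?c + ?c = 0"
      by (subst (2) that) (simp add: commutator_def)
    then show ?thesis by (simp add: double_eq_0_iff commutator_def)
  qed
  then show ?thesis unfolding manin_matrix_def by blast
qed

lemma manin_matrix_iff:
  fixes M :: "'k::complex_algebra ^ 'n::finite ^ 'n"
  shows "(1 - perm_op) * (tensor_left M * tensor_right M) * (1 + perm_op) = 0 \<longleftrightarrow> manin_matrix M"
    (is "?X = 0 \<longleftrightarrow> _")
proof -
  let ?T = "tensor_left M * tensor_right M"
  have "?X = ?T + ?T * perm_op - perm_op * ?T - perm_op * ?T * perm_op"
    by (simp add: algebra_simps)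
  \<comment> \<open>The first and last of the four terms give the first commutator. The middle two
    give \<open>M $ i $ l * M $ k $ j - M $ k $ j * M $ i $ l\<close>, the negative of the
    second.\<close>
  then have "coeff ?X (i, k) (j, l)
      = commutator (M $ i $ j) (M $ k $ l) - commutator (M $ k $ j) (M $ i $ l)" for i j k l
    by (simp add: plus_tensor_algebra.rep_eq minus_tensor_algebra.rep_eq coeff_mult_perm_op
        coeff_perm_op_mult coeff_left_right commutator_def)
  moreover have "?X = 0 \<longleftrightarrow> (\<forall>i j k l. coeff ?X (i, k) (j, l) = 0)"
    by (metis tensor_algebra_eqI zero_tensor_algebra.rep_eq)
  ultimately show ?thesis
    by (simp add: manin_matrix_iff_cross_commutator)
qed

theorem lemma28:
  fixes M :: "'k::complex_algebra ^ 'n::finite ^ 'n"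
  shows "let M1 = tensor_left M; M2 = tensor_right M; P = perm_op :: ('k, 'n) tensor_algebra in
    (commutator M1 M2 = P * commutator M1 M2 \<longleftrightarrow> manin_matrix M) \<and>
    (((1/2) *\<^sub>C (1 - P)) * M1 * M2 * ((1/2) *\<^sub>C (1 - P)) = ((1/2) *\<^sub>C (1 - P)) * M1 * M2
      \<longleftrightarrow> manin_matrix M) \<and>
    (((1/2) *\<^sub>C (1 + P)) * M2 * M1 * ((1/2) *\<^sub>C (1 + P)) = M1 * M2 * ((1/2) *\<^sub>C (1 + P))
      \<longleftrightarrow> manin_matrix M) \<and>
    ((1 - P) * M2 * M1 * (1 + P) = 0 \<longleftrightarrow> manin_matrix M)"
proof -
  \<comment> \<open>These are the two relations that the abstract equivalences assume; with them all
    four equalities reduce to the same vanishing condition.\<close>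
  note inv = perm_op_involution[where 'k = 'k and 'n = 'n] and conj = right_left_eq_conjugate[of M]
  show ?thesis
    unfolding Let_def commutator_flip_iff[OF inv conj] antisymmetrizer_absorb_iff[OF inv conj]
      symmetrizer_absorb_iff[OF inv conj] antisymmetrizer_symmetrizer_iff[OF inv conj] manin_matrix_iff
    by simp
qed

end
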